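(* Let $n_1,\dots,n_d\in\mathbb{N}$, $w=n_1+\dots+n_d$, and $Z_1,\dots,Z_d\in\mathbb{T}$. Let $\vec{\mathfrak{Li}}^o_{n_1,\dots,n_d}(Z_1,\dots,Z_d)=(v_1,\dots,v_d)^{\mathtt T}\in\mathbb{T}^d$ be any branch of the $t$-motivic CMPL and $\vec{\mathfrak{Li}}^{\star,o}_{n_d,\dots,n_1}(Z_d,\dots,Z_1)\in\mathbb{T}^d$ any branch of the $t$-motivic CMSPL (for the reversed index and argument tuples), and let $(s_1,\dots,s_d)^{\mathtt T}:=\vec{\mathfrak{Li}}^{\star,o}_{n_d,\dots,n_1}(-Z_d,\dots,-Z_1)$ be the vector obtained from the latter by multiplying each $\mathfrak{Li}^{\star,o}_{n_i,\dots,n_1}(Z_i,\dots,Z_1)$ by $(-1)^i$, i.e. $s_j=(-1)^{d-j+1}\Omega^{-(n_d+\dots+n_{d-j+2})}\mathfrak{Li}^{\star,o}_{n_{d-j+1},\dots,n_1}(Z_{d-j+1},\dots,Z_1)$. Then $$s_1\Omega^{-w}+s_2v_1+s_3v_2+\dots+s_dv_{d-1}+\Omega^{-w}v_d\in\mathbb{F}_q[[t]]\cdot\Omega^{-2w}.$$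
   Context: Notation: $q$ a prime power, $|\theta|_\infty=q$, $\mathbb{C}_\infty$ the completion of an algebraic closure of $\mathbb{F}_q((1/\theta))$. $\mathbb{T}\subset\mathbb{C}_\infty[[t]]$ the Tate algebra; twist $(\sum a_it^i)^{(m)}=\sum a_i^{q^m}t^i$; $\wp(f)=f-f^{(1)}$, a surjective $\mathbb{F}_q[t]$-linear map $\mathbb{T}\to\mathbb{T}$ with kernel $\mathbb{F}_q[t]$. Fix a $(q-1)$-th root of $-\theta$, $\Omega=(-\theta)^{-q/(q-1)}\prod_{i\ge1}(1-t/\theta^{q^i})$ (invertible in $\mathbb{T}$). CMPL branch: for $Y_1,\dots,Y_r\in\mathbb{T}$, a solution of the depth-$r$ system is $(F_1,\dots,F_r)\in\mathbb{T}^r$ with $\wp(F_i)=Y_{r-i+1}F_{i-1}^{(1)}$, $F_0=1$. A branch value $\vec{\mathfrak{Li}}^o_{n_1,\dots,n_d}(Z_1,\dots,Z_d)$ is a vector $\Omega^{-w}(F_1,\dots,F_d)^{\mathtt T}$ with $(F_i)$ a solution of the depth-$d$ system for $Y_i=\Omega^{n_i}Z_i$; its coordinates are named so that the $j$-th coordinate is $\Omega^{-(n_1+\dots+n_{d-j})}\mathfrak{Li}^o_{n_{d-j+1},\dots,n_d}(Z_{d-j+1},\dots,Z_d)$. CMSPL branch: for $Y_1,\dots,Y_r$, a solution of the star depth-$r$ system is $(F_1,\dots,F_r)$ with $\wp(F_i)=Y_{r-i+1}F_{i-1}$, $F_0=1$. For indices $(m_1,\dots,m_d)$ and arguments $(X_1,\dots,X_d)$,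 a branch value $\vec{\mathfrak{Li}}^{\star,o}_{m_1,\dots,m_d}(X_1,\dots,X_d)$ is a vector $\Omega^{-w}(F_d,\dots,F_1)^{\mathtt T}$ with $(F_i)$ a solution of the star depth-$d$ system for $Y_i=\Omega^{m_i}X_i$; its $j$-th coordinate is written $\Omega^{-(m_1+\dots+m_{j-1})}\mathfrak{Li}^{\star,o}_{m_j,\dots,m_d}(X_j,\dots,X_d)$. In the claim $(m_1,\dots,m_d)=(n_d,\dots,n_1)$ and $(X_1,\dots,X_d)=(Z_d,\dots,Z_1)$. *)

theory Defs
  imports
    "HOL-Analysis.Analysis"
    "HOL-Algebra.Algebraic_Closure_Type"
    "HOL-Computational_Algebra.Formal_Laurent_Series"
begin

text \<open>
  The type \<^typ>\<open>'k fls\<close> plays the role of $\mathbb{F}_q((1/\theta))$, where \<^typ>\<open>'k\<close> is a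
  finite field with $q$ elements. The Laurent series variable is $1/\theta$, so that
  \<^const>\<open>fls_X_inv\<close> is $\theta$ and $|\theta|_\infty = q$.
\<close>

definition laurent_abs :: "'k::{field,finite} fls \<Rightarrow> real" where
  "laurent_abs f = (if f = 0 then 0 else real CARD('k) powi (- fls_subdegree f))"

text \<open>
  The field \<^typ>\<open>'c\<close> with absolute value \<open>absv\<close> is, via \<open>emb\<close>, the completion of the algebraic
  closure of $\mathbb{F}_q((1/\theta))$. The absolute value on the algebraic closure is the
  (unique) extension of \<^const>\<open>laurent_abs\<close>.
\<close>

locale C_infinity =
  fixes emb :: "'k::{field,finite} fls alg_closure \<Rightarrow> 'c::field"
    and absv :: "'c \<Rightarrow> real"
  assumes emb_one: "emb 1 = 1"
    and emb_add: "emb (x + y) = emb x + emb y"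
    and emb_mult: "emb (x * y) = emb x * emb y"
    and absv_nonneg: "absv a \<ge> 0"
    and absv_eq_0_iff: "absv a = 0 \<longleftrightarrow> a = 0"
    and absv_mult: "absv (a * b) = absv a * absv b"
    and absv_add_le_max: "absv (a + b) \<le> max (absv a) (absv b)"
    and absv_emb: "absv (emb (to_ac f)) = laurent_abs f"
    and complete: "Metric_space.mcomplete UNIV (\<lambda>a b. absv (a - b))"
    and dense: "Metric_space.mtopology UNIV (\<lambda>a b. absv (a - b)) closure_of (range emb) = UNIV"

definition theta :: "('k::{field,finite} fls alg_closure \<Rightarrow> 'c::field) \<Rightarrow> 'c" where
  "theta emb = emb (to_ac fls_X_inv)"

definition Fq :: "('k::{field,finite} fls alg_closure \<Rightarrow> 'c::field) \<Rightarrow> 'c set" where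
  "Fq emb = range (\<lambda>c. emb (to_ac (fls_const c)))"

definition Fq_fps :: "('k::{field,finite} fls alg_closure \<Rightarrow> 'c::field) \<Rightarrow> 'c fps set" where
  "Fq_fps emb = {f. \<forall>i. fps_nth f i \<in> Fq emb}"

definition Tate :: "('c::field \<Rightarrow> real) \<Rightarrow> 'c fps set" where
  "Tate absv = {f. (\<lambda>i. absv (fps_nth f i)) \<longlonglongrightarrow> 0}"

definition gauss_norm :: "('c::field \<Rightarrow> real) \<Rightarrow> 'c fps \<Rightarrow> real" where
  "gauss_norm absv f = (SUP i. absv (fps_nth f i))"

definition twist :: "nat \<Rightarrow> nat \<Rightarrow> 'c::field fps \<Rightarrow> 'c fps" where
  "twist q m f = Abs_fps (\<lambda>i. fps_nth f i ^ (q ^ m))"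

definition wp :: "nat \<Rightarrow> 'c::field fps \<Rightarrow> 'c fps" where
  "wp q f = f - twist q 1 f"

text \<open>
  Here \<open>\<rho>\<close> is the chosen $(q-1)$-th root of $-\theta$, so that
  $(-\theta)^{-q/(q-1)}$ is \<open>inverse \<rho> ^ q\<close>.
\<close>

definition Omega_partial ::
  "('k::{field,finite} fls alg_closure \<Rightarrow> 'c::field) \<Rightarrow> 'c \<Rightarrow> nat \<Rightarrow> 'c fps" where
  "Omega_partial emb \<rho> N =
     fps_const (inverse \<rho> ^ CARD('k)) *
     (\<Prod>i=1..N. 1 - fps_const (inverse (theta emb ^ (CARD('k) ^ i))) * fps_X)"

definition Omega ::
  "('k::{field,finite} fls alg_closure \<Rightarrow> 'c::field) \<Rightarrow> ('c \<Rightarrow> real) \<Rightarrow> 'c \<Rightarrow> 'c fps" where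
  "Omega emb absv \<rho> =
     (THE f. f \<in> Tate absv \<and>
             (\<lambda>N. gauss_norm absv (Omega_partial emb \<rho> N - f)) \<longlonglongrightarrow> 0)"

text \<open>The infinite product converges, so the description above determines $\Omega$.\<close>

context C_infinity
begin

lemma absv_zero [simp]: "absv 0 = 0"
  by (simp add: absv_eq_0_iff)

lemma absv_one [simp]: "absv 1 = 1"
proof -
  have "absv 1 * absv 1 = absv 1" by (simp flip: absv_mult)
  moreover have "absv 1 \<noteq> 0" by (simp add: absv_eq_0_iff)
  ultimately show ?thesis by simp
qed

lemma absv_minus [simp]: "absv (- a) = absv a"
proof -
  have "absv (- 1) * absv (- 1) = 1" by (simp flip: absv_mult)
  hence "absv (- 1) = 1"
    using absv_nonneg[of "- 1"] by (metis abs_of_nonneg real_sqrt_abs2 real_sqrt_one)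
  thus ?thesis using absv_mult[of "- 1" a] by simp
qed

lemma absv_diff_commute: "absv (a - b) = absv (b - a)"
  using absv_minus[of "a - b"] by simp

lemma absv_diff_le_max: "absv (a - b) \<le> max (absv a) (absv b)"
  using absv_add_le_max[of a "- b"] by simp

lemma absv_triangle: "absv (a - c) \<le> max (absv (a - b)) (absv (b - c))"
  using absv_add_le_max[of "a - b" "b - c"] by simp

lemma absv_power: "absv (a ^ n) = absv a ^ n"
  by (induction n) (simp_all add: absv_mult)

lemma absv_inverse: "absv (inverse a) = inverse (absv a)"
proof (cases "a = 0")
  case False
  hence "absv a * absv (inverse a) = 1" by (simp flip: absv_mult)
  thus ?thesis by (metis inverse_unique)
qed simp

lemma absv_theta: "absv (theta emb) = real CARD('k)"
  unfolding theta_def absv_emb laurent_abs_def by simp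

sublocale absv_metric: Metric_space UNIV "\<lambda>a b. absv (a - b)"
proof
  fix x y z :: 'c
  show "absv (x - z) \<le> absv (x - y) + absv (y - z)"
    using absv_triangle[of x z y] absv_nonneg[of "x - y"] absv_nonneg[of "y - z"] by linarith
qed (simp_all add: absv_nonneg absv_eq_0_iff absv_diff_commute)

lemma card_ge_2: "CARD('k) \<ge> 2"
proof -
  have "card {0, 1 :: 'k} \<le> CARD('k)" by (intro card_mono) auto
  thus ?thesis by simp
qed

lemma Omega_partial_0: "Omega_partial emb \<rho> 0 = fps_const (inverse \<rho> ^ CARD('k))"
  by (simp add: Omega_partial_def)

lemma Omega_partial_Suc:
  "Omega_partial emb \<rho> (Suc N) = Omega_partial emb \<rho> N -
     fps_const (inverse (theta emb ^ (CARD('k) ^ Suc N))) * (Omega_partial emb \<rho> N * fps_X)"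
  by (simp add: Omega_partial_def algebra_simps)

lemma Omega_partial_nth_0: "fps_nth (Omega_partial emb \<rho> N) 0 = inverse \<rho> ^ CARD('k)"
  by (induction N) (simp_all add: Omega_partial_0 Omega_partial_Suc)

lemma Omega_partial_nth_eq_0: "k > N \<Longrightarrow> fps_nth (Omega_partial emb \<rho> N) k = 0"
  by (induction N arbitrary: k) (auto simp: Omega_partial_0 Omega_partial_Suc)

lemma absv_inverse_theta_power:
  "absv (inverse (theta emb ^ (CARD('k) ^ N))) \<le> (1/2) ^ N"
proof -
  have "N \<le> CARD('k) ^ N"
    using card_ge_2 by (meson less_exp less_imp_le order_trans power_mono zero_le)
  hence "(2::real) ^ N \<le> 2 ^ (CARD('k) ^ N)" by (intro power_increasing) auto
  also have "\<dots> \<le> real CARD('k) ^ (CARD('k) ^ N)"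
    using card_ge_2 by (intro power_mono) auto
  finally show ?thesis
    unfolding absv_inverse absv_power absv_theta
    by (simp add: power_one_over inverse_eq_divide frac_le)
qed

lemma absv_Omega_partial_le:
  "absv (fps_nth (Omega_partial emb \<rho> N) k) \<le> absv (inverse \<rho> ^ CARD('k))"
proof (induction N arbitrary: k)
  case 0
  show ?case by (simp add: Omega_partial_0 absv_nonneg)
next
  case (Suc N)
  let ?c = "inverse (theta emb ^ (CARD('k) ^ Suc N))"
  show ?case
  proof (cases k)
    case 0
    thus ?thesis by (simp add: Omega_partial_nth_0)
  next
    case (Suc k')
    have "absv ?c \<le> (1/2) ^ Suc N" by (rule absv_inverse_theta_power)
    also have "\<dots> \<le> 1" by (intro power_le_one) auto
    finally have "absv ?c * absv (fps_nth (Omega_partial emb \<rho> N) k') \<le>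
        1 * absv (inverse \<rho> ^ CARD('k))"
      by (intro mult_mono Suc.IH) (auto simp: absv_nonneg)
    moreover have "fps_nth (Omega_partial emb \<rho> (Suc N)) k =
        fps_nth (Omega_partial emb \<rho> N) k - ?c * fps_nth (Omega_partial emb \<rho> N) k'"
      using Suc by (simp add: Omega_partial_Suc)
    ultimately show ?thesis
      using absv_diff_le_max[of "fps_nth (Omega_partial emb \<rho> N) k"
          "?c * fps_nth (Omega_partial emb \<rho> N) k'"] Suc.IH[of k]
      by (simp add: absv_mult)
  qed
qed

lemma absv_Omega_partial_diff_le:
  assumes "N \<le> M"
  shows "absv (fps_nth (Omega_partial emb \<rho> M) k - fps_nth (Omega_partial emb \<rho> N) k)
           \<le> (1/2) ^ N * absv (inverse \<rho> ^ CARD('k))"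
  using assms
proof (induction M rule: dec_induct)
  case base
  show ?case by (simp add: absv_nonneg)
next
  case (step M)
  let ?c = "inverse (theta emb ^ (CARD('k) ^ Suc M))"
  let ?P = "\<lambda>M. fps_nth (Omega_partial emb \<rho> M) k"
  have "absv (?P (Suc M) - ?P M) \<le> (1/2) ^ N * absv (inverse \<rho> ^ CARD('k))"
  proof (cases k)
    case 0
    thus ?thesis by (simp add: Omega_partial_nth_0 absv_nonneg)
  next
    case (Suc k')
    have "absv ?c \<le> (1/2) ^ Suc M" by (rule absv_inverse_theta_power)
    also have "\<dots> \<le> (1/2) ^ N" using step by (intro power_decreasing) auto
    finally have "absv ?c * absv (fps_nth (Omega_partial emb \<rho> M) k') \<le>
        (1/2) ^ N * absv (inverse \<rho> ^ CARD('k))"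
      by (intro mult_mono absv_Omega_partial_le) (auto simp: absv_nonneg)
    moreover have "?P (Suc M) - ?P M = - (?c * fps_nth (Omega_partial emb \<rho> M) k')"
      using Suc by (simp add: Omega_partial_Suc)
    ultimately show ?thesis by (simp only: absv_minus absv_mult)
  qed
  thus ?case using step.IH absv_triangle[of "?P (Suc M)" "?P N" "?P M"] by linarith
qed

lemma half_power_mult_tendsto_0: "(\<lambda>N. (1/2) ^ N * (C::real)) \<longlonglongrightarrow> 0"
  by (rule tendsto_mult_left_zero, rule LIMSEQ_power_zero) simp

lemma Tate_bdd_above: "f \<in> Tate absv \<Longrightarrow> bdd_above (range (\<lambda>i. absv (fps_nth f i)))"
  by (auto simp: Tate_def intro!: Bseq_bdd_above convergent_imp_Bseq convergentI)

lemma Tate_diff: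
  assumes "f \<in> Tate absv" "g \<in> Tate absv"
  shows "f - g \<in> Tate absv"
  unfolding Tate_def
proof (clarify, rule tendsto_sandwich[OF _ _ tendsto_const])
  show "\<forall>\<^sub>F i in sequentially. absv (fps_nth (f - g) i) \<le>
      absv (fps_nth f i) + absv (fps_nth g i)"
  proof (intro always_eventually allI)
    fix i
    show "absv (fps_nth (f - g) i) \<le> absv (fps_nth f i) + absv (fps_nth g i)"
      using absv_diff_le_max[of "fps_nth f i" "fps_nth g i"]
        absv_nonneg[of "fps_nth f i"] absv_nonneg[of "fps_nth g i"] by simp
  qed
  show "(\<lambda>i. absv (fps_nth f i) + absv (fps_nth g i)) \<longlonglongrightarrow> 0"
    using tendsto_add[of "\<lambda>i. absv (fps_nth f i)" 0 _ "\<lambda>i. absv (fps_nth g i)" 0] assms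
    by (simp add: Tate_def)
qed (simp add: absv_nonneg)

lemma Omega_partial_Tate: "Omega_partial emb \<rho> N \<in> Tate absv"
  unfolding Tate_def
proof clarify
  have "\<forall>\<^sub>F i in sequentially. absv (fps_nth (Omega_partial emb \<rho> N) i) = 0"
    using eventually_gt_at_top[of N]
    by eventually_elim (simp add: Omega_partial_nth_eq_0)
  thus "(\<lambda>i. absv (fps_nth (Omega_partial emb \<rho> N) i)) \<longlonglongrightarrow> 0"
    by (rule tendsto_eventually)
qed

lemma Omega_limit_nth:
  assumes "f \<in> Tate absv" and "(\<lambda>N. gauss_norm absv (Omega_partial emb \<rho> N - f)) \<longlonglongrightarrow> 0"
  shows "limitin absv_metric.mtopology (\<lambda>N. fps_nth (Omega_partial emb \<rho> N) k)
           (fps_nth f k) sequentially"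
proof -
  have le: "absv (fps_nth (Omega_partial emb \<rho> N) k - fps_nth f k) \<le>
      gauss_norm absv (Omega_partial emb \<rho> N - f)" for N
    unfolding gauss_norm_def
    using cSUP_upper[OF UNIV_I Tate_bdd_above[OF Tate_diff[OF Omega_partial_Tate[of \<rho> N] assms(1)]],
        of k]
    by simp
  show ?thesis
    unfolding absv_metric.limitin_metric
  proof (intro conjI allI impI UNIV_I)
    fix \<epsilon> :: real assume "\<epsilon> > 0"
    hence "\<forall>\<^sub>F N in sequentially. gauss_norm absv (Omega_partial emb \<rho> N - f) < \<epsilon>"
      using assms(2) by (simp add: order_tendstoD)
    thus "\<forall>\<^sub>F N in sequentially. fps_nth (Omega_partial emb \<rho> N) k \<in> UNIV \<and>
        absv (fps_nth (Omega_partial emb \<rho> N) k - fps_nth f k) < \<epsilon>"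
      by eventually_elim (use le in \<open>auto intro: le_less_trans\<close>)
  qed
qed

lemma Omega_ex1:
  "\<exists>!f. f \<in> Tate absv \<and> (\<lambda>N. gauss_norm absv (Omega_partial emb \<rho> N - f)) \<longlonglongrightarrow> 0"
proof (rule ex_ex1I)
  let ?P = "\<lambda>N k. fps_nth (Omega_partial emb \<rho> N) k"
  define C where "C = absv (inverse \<rho> ^ CARD('k))"
  have "\<exists>x. limitin absv_metric.mtopology (\<lambda>N. ?P N k) x sequentially" for k
  proof -
    have "absv_metric.MCauchy (\<lambda>N. ?P N k)"
      unfolding absv_metric.MCauchy_def
    proof (intro conjI allI impI)
      fix \<epsilon> :: real assume "\<epsilon> > 0"
      hence "\<forall>\<^sub>F N in sequentially. (1/2) ^ N * C < \<epsilon>"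
        using half_power_mult_tendsto_0[of C] by (simp add: order_tendstoD)
      then obtain N where N: "(1/2) ^ N * C < \<epsilon>"
        by (auto simp: eventually_sequentially)
      have "absv (?P n k - ?P n' k) < \<epsilon>" if "N \<le> n" "N \<le> n'" for n n'
        using absv_Omega_partial_diff_le[OF that(1), of \<rho> k]
          absv_Omega_partial_diff_le[OF that(2), of \<rho> k]
          absv_triangle[of "?P n k" "?P n' k" "?P N k"] N
          absv_diff_commute[of "?P n' k" "?P N k"] by (simp add: C_def)
      thus "\<exists>N. \<forall>n n'. N \<le> n \<longrightarrow> N \<le> n' \<longrightarrow> absv (?P n k - ?P n' k) < \<epsilon>" by blast
    qed simp
    thus ?thesis using complete by (simp add: absv_metric.mcomplete_def)
  qed
  then obtain L where L: "limitin absv_metric.mtopology (\<lambda>N. ?P N k) (L k) sequentially" for k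
    by metis
  have le: "absv (?P N k - L k) \<le> (1/2) ^ N * C" for N k
  proof (rule ccontr)
    assume *: "\<not> absv (?P N k - L k) \<le> (1/2) ^ N * C"
    hence "absv (?P N k - L k) > 0"
      by (smt (verit) C_def absv_nonneg mult_nonneg_nonneg zero_le_power zero_le_divide_1_iff)
    hence "\<forall>\<^sub>F M in sequentially. absv (?P M k - L k) < absv (?P N k - L k)"
      using L[of k] unfolding absv_metric.limitin_metric by simp
    hence "\<forall>\<^sub>F M in sequentially. absv (?P M k - L k) < absv (?P N k - L k) \<and> N \<le> M"
      using eventually_ge_at_top[of N] by (rule eventually_conj)
    then obtain M where M: "absv (?P M k - L k) < absv (?P N k - L k)" "N \<le> M"
      by (auto simp: eventually_sequentially)
    have "absv (?P M k - ?P N k) \<le> (1/2) ^ N * C"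
      using absv_Omega_partial_diff_le[OF M(2), of \<rho> k] by (simp add: C_def)
    thus False
      using M(1) * absv_triangle[of "?P N k" "L k" "?P M k"]
        absv_diff_commute[of "?P M k" "?P N k"] by simp
  qed
  define f where "f = Abs_fps L"
  have "f \<in> Tate absv"
    unfolding Tate_def
  proof (clarify, rule LIMSEQ_imp_Suc, rule tendsto_sandwich[OF _ _ tendsto_const])
    show "\<forall>\<^sub>F i in sequentially. absv (fps_nth f (Suc i)) \<le> (1/2) ^ i * C"
    proof (intro always_eventually allI)
      fix i show "absv (fps_nth f (Suc i)) \<le> (1/2) ^ i * C"
        using le[of i "Suc i"] by (simp add: f_def Omega_partial_nth_eq_0)
    qed
  qed (simp add: absv_nonneg, rule half_power_mult_tendsto_0)
  moreover have "(\<lambda>N. gauss_norm absv (Omega_partial emb \<rho> N - f)) \<longlonglongrightarrow> 0"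
  proof (rule tendsto_sandwich[OF _ _ tendsto_const])
    show "\<forall>\<^sub>F N in sequentially. gauss_norm absv (Omega_partial emb \<rho> N - f) \<le> (1/2) ^ N * C"
      unfolding gauss_norm_def
      by (intro always_eventually allI cSUP_least) (simp_all add: f_def le)
    show "\<forall>\<^sub>F N in sequentially. 0 \<le> gauss_norm absv (Omega_partial emb \<rho> N - f)"
    proof (intro always_eventually allI)
      fix N
      have "absv (fps_nth (Omega_partial emb \<rho> N - f) 0) \<le>
          gauss_norm absv (Omega_partial emb \<rho> N - f)"
        unfolding gauss_norm_def
        by (rule cSUP_upper[OF UNIV_I]) (auto simp: f_def intro!: bdd_aboveI2 le)
      thus "0 \<le> gauss_norm absv (Omega_partial emb \<rho> N - f)"
        using absv_nonneg order_trans by blast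
    qed
  qed (rule half_power_mult_tendsto_0)
  ultimately show "\<exists>f. f \<in> Tate absv \<and>
      (\<lambda>N. gauss_norm absv (Omega_partial emb \<rho> N - f)) \<longlonglongrightarrow> 0" by blast
next
  fix f g
  assume "f \<in> Tate absv \<and> (\<lambda>N. gauss_norm absv (Omega_partial emb \<rho> N - f)) \<longlonglongrightarrow> 0"
    and "g \<in> Tate absv \<and> (\<lambda>N. gauss_norm absv (Omega_partial emb \<rho> N - g)) \<longlonglongrightarrow> 0"
  thus "f = g"
    using Omega_limit_nth[of f \<rho>] Omega_limit_nth[of g \<rho>]
    by (intro fps_ext absv_metric.limitin_metric_unique[OF _ _ trivial_limit_sequentially]) auto
qed

lemma Omega_Tate: "Omega emb absv \<rho> \<in> Tate absv"
  and Omega_limit: "(\<lambda>N. gauss_norm absv (Omega_partial emb \<rho> N - Omega emb absv \<rho>)) \<longlonglongrightarrow> 0"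
  using theI'[OF Omega_ex1[of \<rho>]] by (simp_all add: Omega_def)

lemma Omega_nth_0: "fps_nth (Omega emb absv \<rho>) 0 = inverse \<rho> ^ CARD('k)"
proof -
  have "limitin absv_metric.mtopology (\<lambda>N. inverse \<rho> ^ CARD('k))
          (fps_nth (Omega emb absv \<rho>) 0) sequentially"
    using Omega_limit_nth[OF Omega_Tate Omega_limit, of \<rho> 0] by (simp add: Omega_partial_nth_0)
  moreover have "limitin absv_metric.mtopology (\<lambda>N. inverse \<rho> ^ CARD('k))
          (inverse \<rho> ^ CARD('k)) sequentially"
    by simp
  ultimately show ?thesis
    by (intro absv_metric.limitin_metric_unique[OF _ _ trivial_limit_sequentially])
qed

end

text \<open>All tuples are functions on \<^typ>\<open>nat\<close> whose relevant indices are \<open>1..r\<close>.\<close>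

definition cmpl_solution ::
  "nat \<Rightarrow> ('c::field \<Rightarrow> real) \<Rightarrow> nat \<Rightarrow> (nat \<Rightarrow> 'c fps) \<Rightarrow> (nat \<Rightarrow> 'c fps) \<Rightarrow> bool" where
  "cmpl_solution q absv r Y F \<longleftrightarrow>
     F 0 = 1 \<and>
     (\<forall>i\<in>{1..r}. F i \<in> Tate absv \<and> wp q (F i) = Y (r - i + 1) * twist q 1 (F (i - 1)))"

definition cmspl_solution ::
  "nat \<Rightarrow> ('c::field \<Rightarrow> real) \<Rightarrow> nat \<Rightarrow> (nat \<Rightarrow> 'c fps) \<Rightarrow> (nat \<Rightarrow> 'c fps) \<Rightarrow> bool" where
  "cmspl_solution q absv r Y F \<longleftrightarrow>
     F 0 = 1 \<and>
     (\<forall>i\<in>{1..r}. F i \<in> Tate absv \<and> wp q (F i) = Y (r - i + 1) * F (i - 1))"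

text \<open>The argument \<open>W\<close> below stands for $\Omega$.\<close>

definition cmpl_branch ::
  "nat \<Rightarrow> ('c::field \<Rightarrow> real) \<Rightarrow> 'c fps \<Rightarrow> nat \<Rightarrow> (nat \<Rightarrow> nat) \<Rightarrow> (nat \<Rightarrow> 'c fps)
     \<Rightarrow> (nat \<Rightarrow> 'c fps) \<Rightarrow> bool" where
  "cmpl_branch q absv W d n Z v \<longleftrightarrow>
     (\<exists>F. cmpl_solution q absv d (\<lambda>i. W ^ n i * Z i) F \<and>
          (\<forall>j\<in>{1..d}. v j = inverse W ^ (\<Sum>i=1..d. n i) * F j))"

definition cmspl_branch ::
  "nat \<Rightarrow> ('c::field \<Rightarrow> real) \<Rightarrow> 'c fps \<Rightarrow> nat \<Rightarrow> (nat \<Rightarrow> nat) \<Rightarrow> (nat \<Rightarrow> 'c fps)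
     \<Rightarrow> (nat \<Rightarrow> 'c fps) \<Rightarrow> bool" where
  "cmspl_branch q absv W d m Z u \<longleftrightarrow>
     (\<exists>F. cmspl_solution q absv d (\<lambda>i. W ^ m i * Z i) F \<and>
          (\<forall>j\<in>{1..d}. u j = inverse W ^ (\<Sum>i=1..d. m i) * F (d - j + 1)))"

text \<open>
  For a star branch vector \<open>u\<close> with index tuple \<open>m\<close>, the value $\mathfrak{Li}^{\star,o}_{m_j,\dots,m_d}$
  is determined by the convention that \<open>u j\<close> is $\Omega^{-(m_1+\dots+m_{j-1})}$ times it.
\<close>

definition star_Li ::
  "'c::field fps \<Rightarrow> (nat \<Rightarrow> nat) \<Rightarrow> (nat \<Rightarrow> 'c fps) \<Rightarrow> nat \<Rightarrow> 'c fps" where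
  "star_Li W m u j = W ^ (\<Sum>i=1..<j. m i) * u j"

text \<open>
  The vector obtained from \<open>u\<close> by multiplying each depth-\<open>i\<close> star value by $(-1)^i$; the value
  in the \<open>j\<close>-th coordinate has depth \<open>d - j + 1\<close>.
\<close>

definition star_signed ::
  "'c::field fps \<Rightarrow> nat \<Rightarrow> (nat \<Rightarrow> nat) \<Rightarrow> (nat \<Rightarrow> 'c fps) \<Rightarrow> nat \<Rightarrow> 'c fps" where
  "star_signed W d m u j =
     (-1) ^ (d - j + 1) * inverse W ^ (\<Sum>i=1..<j. m i) * star_Li W m u j"

end

theory Submission
  imports Defs
begin

text \<open>
  Put \<open>Y\<^sub>i = \<Omega>\<^bsup>n\<^sub>i\<^esup> Z\<^sub>i\<close>, let \<open>F\<close> solve the system defining the given branch and \<open>G\<close> the star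
  system for the reversed tuples, so that \<open>F\<^sub>k = F\<^sub>k\<^sup>' + Y\<^bsub>d-k+1\<^esub> F\<^bsub>k-1\<^esub>\<^sup>'\<close> and
  \<open>G\<^sub>k = G\<^sub>k\<^sup>' + Y\<^sub>k G\<^bsub>k-1\<^esub>\<close>, a prime denoting the twist. Up to the factor \<open>\<Omega>\<^bsup>-2w\<^esup>\<close> the sum in
  question is \<open>\<Sum>\<^sub>k (-1)\<^bsup>d-k\<^esup> G\<^bsub>d-k\<^esub> F\<^sub>k\<close>. Its difference from its own twist telescopes to \<open>0\<close>, and
  the series fixed by the twist are those with coefficients in \<open>\<F>\<^sub>q\<close>.
\<close>

section \<open>The \<open>q\<close>-th power map on a finite field with \<open>q\<close>
  elements\<close>

lemma finite_field_power_card: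
  fixes x :: "'a :: {field, finite}"
  shows "x ^ CARD('a) = x"
proof (cases "x = 0")
  case False
  \<comment> \<open>Multiplication by a nonzero \<open>x\<close> permutes the nonzero
    elements.\<close>
  have "(\<Prod>y\<in>UNIV-{0}. y) = (\<Prod>y\<in>UNIV-{0}. x * y)"
    by (rule prod.reindex_bij_witness[of _ "\<lambda>y. x * y" "\<lambda>y. y / x"]) (use False in auto)
  also have "\<dots> = x ^ (CARD('a) - 1) * (\<Prod>y\<in>UNIV-{0}. y)"
    by (simp add: prod.distrib)
  finally have "x ^ (CARD('a) - 1) = 1"
    by simp
  moreover have "x ^ CARD('a) = x * x ^ (CARD('a) - 1)"
    by (simp flip: power_Suc)
  ultimately show ?thesis by simp
qed simp

text \<open>
  The polynomials \<open>(X + 1)\<^sup>q\<close> and \<open>X\<^sup>q + 1\<close> are monic of degree \<open>q\<close> and agree on all \<open>q\<close> elements of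
  the field, hence coincide. This gives additivity of the \<open>q\<close>-th power without knowing that \<open>q\<close> is
  a power of the characteristic.
\<close>

lemma of_nat_card_choose_eq_0:
  assumes "0 < i" "i < CARD('a :: {field, finite})"
  shows "of_nat (CARD('a) choose i) = (0 :: 'a)"
proof -
  let ?q = "CARD('a)"
  have "[:1, 1 :: 'a:] ^ ?q = Polynomial.monom 1 ?q + 1"
  proof (rule poly_eqI_degree_lead_coeff[where n = ?q and A = UNIV])
    show "Polynomial.coeff ([:1, 1 :: 'a:] ^ ?q) ?q = Polynomial.coeff (Polynomial.monom 1 ?q + 1) ?q"
      by (simp add: coeff_linear_power)
    show "Polynomial.degree ([:1, 1 :: 'a:] ^ ?q) \<le> ?q"
      by (rule order_trans[OF degree_power_le]) simp
    show "Polynomial.degree (Polynomial.monom (1::'a) ?q + 1) \<le> ?q"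
      by (intro degree_add_le degree_monom_le) simp
  qed (simp_all add: poly_monom finite_field_power_card add.commute)
  hence "Polynomial.coeff ([:1, 1 :: 'a:] ^ ?q) i = Polynomial.coeff (Polynomial.monom 1 ?q + 1) i"
    by simp
  thus ?thesis
    using assms by (simp add: coeff_linear_poly_power)
qed

section \<open>The telescoping identity, over any commutative ring\<close>

lemma alternating_sum_eq:
  fixes F F' G G' Y :: "nat \<Rightarrow> 'a :: comm_ring_1"
  assumes F0: "F 0 = F' 0" and F: "\<And>k. k < d \<Longrightarrow> F (Suc k) = F' (Suc k) + Y (d - k) * F' k"
    and G0: "G 0 = G' 0" and G: "\<And>k. k < d \<Longrightarrow> G (Suc k) = G' (Suc k) + Y (Suc k) * G k"
  shows "(\<Sum>k\<le>d. (-1) ^ (d - k) * (G (d - k) * F k)) = (\<Sum>k\<le>d. (-1) ^ (d - k) * (G' (d - k) * F' k))"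
proof -
  \<comment> \<open>In the signed summand, replacing \<open>F k\<close> by \<open>F' k\<close> costs
    \<open>T k\<close>, and then replacing \<open>G (d - k)\<close> by \<open>G' (d - k)\<close>
    costs \<open>- T (Suc k)\<close>. The zero values match \<open>F 0 = F' 0\<close> and
    \<open>G 0 = G' 0\<close> and kill both ends of the telescope.\<close>
  define T where "T k = (if k = 0 then 0 else if k > d then 0
      else (-1) ^ (d - k) * (G (d - k) * Y (Suc (d - k)) * F' (k - 1)))" for k
  have left: "(-1) ^ (d - k) * (G (d - k) * (F k - F' k)) = T k" if "k \<le> d" for k
  proof (cases k)
    case (Suc j)
    with that have "d - j = Suc (d - k)" by simp
    thus ?thesis using F[of j] Suc that by (simp add: T_def mult_ac)
  qed (simp add: T_def F0)
  have right: "(-1) ^ (d - k) * ((G (d - k) - G' (d - k)) * F' k) = - T (Suc k)" if "k \<le> d" for k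
  proof (cases "k = d")
    case False
    with that obtain j where j: "d - k = Suc j" "j < d"
      by (metis diff_less_Suc Suc_diff_Suc le_neq_implies_less less_Suc_eq_le not_less_eq)
    hence "d - Suc k = j" by simp
    thus ?thesis using G[OF j(2)] j(1) that False by (simp add: T_def mult_ac)
  qed (simp add: T_def G0)
  have "(\<Sum>k\<le>d. (-1) ^ (d - k) * (G (d - k) * F k)) - (\<Sum>k\<le>d. (-1) ^ (d - k) * (G' (d - k) * F' k))
      = (\<Sum>k\<le>d. T k - T (Suc k))"
    unfolding sum_subtractf[symmetric]
  proof (rule sum.cong[OF refl])
    fix k assume "k \<in> {..d}"
    hence k: "k \<le> d" by simp
    show "(-1) ^ (d - k) * (G (d - k) * F k) - (-1) ^ (d - k) * (G' (d - k) * F' k) = T k - T (Suc k)"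
      unfolding left[OF k, symmetric] diff_conv_add_uminus[of "(-1) ^ (d - k) * (G (d - k) * (F k - F' k))"]
        right[OF k, symmetric]
      by (simp add: algebra_simps)
  qed
  also have "\<dots> = T 0 - T (Suc d)"
    by (rule sum_telescope)
  finally show ?thesis by (simp add: T_def)
qed

section \<open>Additivity of the \<open>q\<close>-th power on the big field and its fixed
  points\<close>

context C_infinity
begin

definition emb_const :: "'k \<Rightarrow> 'c" where
  "emb_const c = emb (to_ac (fls_const c))"

lemma emb_zero: "emb 0 = 0"
  by (metis add_0 add_cancel_right_left emb_add)

lemma emb_of_nat: "emb (of_nat m) = of_nat m"
  by (induction m) (simp_all add: emb_zero emb_one emb_add)

lemma emb_power: "emb (x ^ m) = emb x ^ m"
  by (induction m) (simp_all add: emb_one emb_mult)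

lemma emb_const_power: "emb_const (c ^ m) = emb_const c ^ m"
  by (simp add: emb_const_def fls_const_power emb_power)

lemma emb_const_of_nat: "emb_const (of_nat m) = of_nat m"
  by (simp add: emb_const_def emb_of_nat flip: fls_of_nat)

text \<open>A nonzero constant has nonzero \<open>laurent_abs\<close>, which \<open>absv_emb\<close>
  transports along the embedding.\<close>

lemma inj_emb_const: "inj emb_const"
proof (rule injI)
  fix a b assume "emb_const a = emb_const b"
  moreover have "emb_const a = emb_const (a - b) + emb_const b"
    by (simp add: emb_const_def fls_plus_const flip: emb_add to_ac_add)
  ultimately have "absv (emb_const (a - b)) = 0"
    by simp
  thus "a = b"
    by (auto simp: emb_const_def absv_emb laurent_abs_def split: if_splits)
qed

text \<open>The vanishing in the finite field is carried over by \<open>emb_const\<close>, which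
  respects natural numbers.\<close>

lemma of_nat_choose_eq_0:
  assumes "0 < i" "i < CARD('k)"
  shows "of_nat (CARD('k) choose i) = (0 :: 'c)"
proof -
  have "of_nat (CARD('k) choose i) = emb_const (of_nat (CARD('k) choose i) :: 'k)"
    by (simp add: emb_const_of_nat)
  thus ?thesis
    using of_nat_card_choose_eq_0[OF assms] by (simp add: emb_const_def emb_zero)
qed

lemma add_power_card: "(a + b :: 'c) ^ CARD('k) = a ^ CARD('k) + b ^ CARD('k)"
proof -
  let ?q = "CARD('k)"
  let ?f = "\<lambda>i. of_nat (?q choose i) * a ^ i * b ^ (?q - i)"
  have "(a + b) ^ ?q = sum ?f {..?q}"
    by (rule binomial_ring)
  also have "\<dots> = sum ?f {0, ?q}"
    by (rule sum.mono_neutral_right) (auto simp: of_nat_choose_eq_0)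
  finally show ?thesis
    by (simp add: add.commute)
qed

lemma sum_power_card: "(\<Sum>x\<in>A. f x :: 'c) ^ CARD('k) = (\<Sum>x\<in>A. f x ^ CARD('k))"
  by (induction A rule: infinite_finite_induct) (simp_all add: add_power_card)

text \<open>The nonzero polynomial \<open>X^q - X\<close> has at most \<open>q\<close> roots, and
  the \<open>q\<close> embedded constants are already roots.\<close>

lemma power_card_eq_self_imp_Fq:
  assumes "a ^ CARD('k) = a"
  shows "a \<in> Fq emb"
proof -
  let ?q = "CARD('k)"
  let ?p = "Polynomial.monom 1 ?q - Polynomial.monom 1 1 :: 'c poly"
  have "Polynomial.coeff ?p ?q = 1"
    using card_ge_2 by simp
  hence nz: "?p \<noteq> 0" by (metis coeff_0 zero_neq_one)
  have roots: "{x. poly ?p x = 0} = {x. x ^ ?q = x}"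
    by (simp add: poly_monom)
  have "Polynomial.degree ?p \<le> ?q"
    using card_ge_2 by (intro degree_diff_le) (auto intro: order_trans[OF degree_monom_le])
  hence "card {x :: 'c. x ^ ?q = x} \<le> card (range emb_const)"
    using card_poly_roots_bound[OF nz] unfolding roots by (simp add: card_image inj_emb_const)
  moreover have "range emb_const \<subseteq> {x. x ^ ?q = x}"
    by (auto simp: finite_field_power_card simp flip: emb_const_power)
  moreover have "finite {x :: 'c. x ^ ?q = x}"
    using poly_roots_finite[OF nz] by (simp only: roots)
  ultimately have "range emb_const = {x. x ^ ?q = x}"
    by (intro card_seteq) auto
  thus ?thesis
    using assms by (auto simp: Fq_def emb_const_def[abs_def])
qed

section \<open>The twist as a ring endomorphism and its fixed series\<close>

lemma twist_nth: "fps_nth (twist q 1 f) i = fps_nth f i ^ q"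
  by (simp add: twist_def)

lemma twist_one: "twist CARD('k) 1 1 = (1 :: 'c fps)"
  by (rule fps_ext) (simp add: twist_nth del: One_nat_def)

lemma twist_add: "twist CARD('k) 1 (f + g :: 'c fps) = twist CARD('k) 1 f + twist CARD('k) 1 g"
  by (rule fps_ext) (simp add: twist_nth add_power_card del: One_nat_def)

lemma twist_mult: "twist CARD('k) 1 (f * g :: 'c fps) = twist CARD('k) 1 f * twist CARD('k) 1 g"
  by (rule fps_ext) (simp add: twist_nth fps_mult_nth sum_power_card power_mult_distrib del: One_nat_def)

lemma twist_zero: "twist CARD('k) 1 0 = (0 :: 'c fps)"
  by (rule fps_ext) (simp add: twist_nth del: One_nat_def)

text \<open>Deducing this from additivity avoids a case distinction on the parity of
  \<open>q\<close>.\<close>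

lemma twist_minus: "twist CARD('k) 1 (- f :: 'c fps) = - twist CARD('k) 1 f"
  using twist_add[of f "- f"] by (simp add: twist_zero eq_neg_iff_add_eq_0 add.commute del: One_nat_def)

lemma twist_power: "twist CARD('k) 1 (f ^ m :: 'c fps) = twist CARD('k) 1 f ^ m"
  by (induction m) (simp_all add: twist_one twist_mult del: One_nat_def)

lemma twist_sum: "twist CARD('k) 1 (\<Sum>x\<in>A. f x :: 'c fps) = (\<Sum>x\<in>A. twist CARD('k) 1 (f x))"
  by (induction A rule: infinite_finite_induct) (simp_all add: twist_zero twist_add del: One_nat_def)

lemma twist_eq_self_imp_Fq_fps:
  assumes "twist CARD('k) 1 f = f"
  shows "f \<in> Fq_fps emb"
  unfolding Fq_fps_def
proof (intro CollectI allI power_card_eq_self_imp_Fq)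
  show "fps_nth f i ^ CARD('k) = fps_nth f i" for i
    using twist_nth[of "CARD('k)" f i] by (simp only: assms)
qed

lemma cmpl_cmspl_alternating_sum_in_Fq_fps:
  assumes F: "cmpl_solution CARD('k) absv d Y F"
    and G: "cmspl_solution CARD('k) absv d (\<lambda>i. Y (d + 1 - i)) G"
  shows "(\<Sum>k\<le>d. (-1) ^ (d - k) * (G (d - k) * F k)) \<in> Fq_fps emb"
proof (rule twist_eq_self_imp_Fq_fps)
  let ?\<tau> = "twist CARD('k) 1"
  have F1: "F (Suc k) = ?\<tau> (F (Suc k)) + Y (d - k) * ?\<tau> (F k)" if "k < d" for k
  proof -
    have "wp CARD('k) (F (Suc k)) = Y (d - Suc k + 1) * ?\<tau> (F k)"
      using F that unfolding cmpl_solution_def by force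
    moreover have "d - Suc k + 1 = d - k" using that by simp
    ultimately show ?thesis by (simp add: wp_def algebra_simps)
  qed
  have G1: "G (Suc k) = ?\<tau> (G (Suc k)) + Y (Suc k) * G k" if "k < d" for k
  proof -
    \<comment> \<open>The star system reverses an already reversed tuple, so the index comes back to
      \<open>Suc k\<close>.\<close>
    have "wp CARD('k) (G (Suc k)) = Y (d + 1 - (d - Suc k + 1)) * G k"
      using G that unfolding cmspl_solution_def by force
    moreover have "d + 1 - (d - Suc k + 1) = Suc k" using that by simp
    ultimately show ?thesis by (simp add: wp_def algebra_simps)
  qed
  have "(\<Sum>k\<le>d. (-1) ^ (d - k) * (G (d - k) * F k)) =
      (\<Sum>k\<le>d. (-1) ^ (d - k) * (?\<tau> (G (d - k)) * ?\<tau> (F k)))"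
    by (rule alternating_sum_eq[where Y = Y])
      (use F G F1 G1 in \<open>simp_all add: cmpl_solution_def cmspl_solution_def twist_one del: One_nat_def\<close>)
  also have "\<dots> = ?\<tau> (\<Sum>k\<le>d. (-1) ^ (d - k) * (G (d - k) * F k))"
    by (simp add: twist_sum twist_mult twist_power twist_minus twist_one del: One_nat_def)
  finally show "?\<tau> (\<Sum>k\<le>d. (-1) ^ (d - k) * (G (d - k) * F k)) =
      (\<Sum>k\<le>d. (-1) ^ (d - k) * (G (d - k) * F k))" ..
qed

text \<open>This makes \<open>inverse W\<close> a genuine inverse in the ring of power
  series.\<close>

lemma Omega_nth_0_nonzero:
  assumes "\<rho> ^ (CARD('k) - 1) = - theta emb"
  shows "fps_nth (Omega emb absv \<rho>) 0 \<noteq> 0"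
proof -
  have "theta emb \<noteq> 0"
    using absv_theta card_ge_2 by auto
  hence "\<rho> \<noteq> 0"
    using assms card_ge_2 by (auto simp: power_0_left split: if_splits)
  thus ?thesis by (simp add: Omega_nth_0)
qed

end

lemma star_signed_eq:
  assumes "fps_nth W 0 \<noteq> 0"
  shows "star_signed W d m u j = (-1) ^ (d - j + 1) * u j"
proof -
  have "inverse W ^ e * (W ^ e * u j) = u j" for e
    using assms by (simp add: inverse_mult_eq_1 flip: mult.assoc power_mult_distrib)
  thus ?thesis by (simp add: star_signed_def star_Li_def mult.assoc)
qed

theorem theorem2p5:
  fixes emb :: "'k::{field,finite} fls alg_closure \<Rightarrow> 'c::field"
    and absv :: "'c \<Rightarrow> real"
    and \<rho> :: 'c
    and W :: "'c fps"
    and d w :: nat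
    and n :: "nat \<Rightarrow> nat"
    and Z u v s :: "nat \<Rightarrow> 'c fps"
  defines "W \<equiv> Omega emb absv \<rho>"
    and "w \<equiv> (\<Sum>i=1..d. n i)"
  assumes "C_infinity emb absv"
    and "\<rho> ^ (CARD('k) - 1) = - theta emb"
    and "d \<ge> 1"
    and "\<forall>i\<in>{1..d}. Z i \<in> Tate absv"
    and "cmpl_branch CARD('k) absv W d n Z v"
    and "cmspl_branch CARD('k) absv W d (\<lambda>i. n (d + 1 - i)) (\<lambda>i. Z (d + 1 - i)) u"
    and "\<forall>j\<in>{1..d}. s j = star_signed W d (\<lambda>i. n (d + 1 - i)) u j"
  shows "s 1 * inverse W ^ w + (\<Sum>j=2..d. s j * v (j - 1)) + inverse W ^ w * v d
           \<in> {g * inverse W ^ (2 * w) | g. g \<in> Fq_fps emb}"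
proof -
  interpret C_infinity emb absv by fact
  define Y where "Y i = W ^ n i * Z i" for i
  define I where "I = inverse W ^ w"
  have w_rev: "(\<Sum>i=1..d. n (d + 1 - i)) = w"
    unfolding w_def
    by (rule sum.reindex_bij_witness[of _ "\<lambda>i. d + 1 - i" "\<lambda>i. d + 1 - i"]) auto
  obtain F where F: "cmpl_solution CARD('k) absv d Y F" and v: "\<forall>j\<in>{1..d}. v j = I * F j"
    using assms(7) unfolding cmpl_branch_def Y_def I_def w_def by blast
  obtain G where G: "cmspl_solution CARD('k) absv d (\<lambda>i. Y (d + 1 - i)) G"
    and u: "\<forall>j\<in>{1..d}. u j = I * G (d - j + 1)"
    using assms(8) unfolding cmspl_branch_def Y_def I_def w_rev by blast
  have F0: "F 0 = 1" and G0: "G 0 = 1"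
    using F G by (simp_all add: cmpl_solution_def cmspl_solution_def)
  \<comment> \<open>Reading the missing \<open>v 0\<close> and \<open>s (d + 1)\<close> as
    \<open>I\<close>, each product \<open>s (Suc k) * v k\<close> equals \<open>I * I * g k\<close>,
    so the three pieces of the claim form one sum over \<open>k \<le> d\<close>.\<close>
  define g where "g k = (-1) ^ (d - k) * (G (d - k) * F k)" for k
  have s: "s (Suc k) = (-1) ^ (d - k) * (I * G (d - k))" if "k < d" for k
  proof -
    have "d - Suc k + 1 = d - k" using that by simp
    moreover have "s (Suc k) = (-1) ^ (d - Suc k + 1) * (I * G (d - Suc k + 1))"
      using assms(9) u that star_signed_eq[OF Omega_nth_0_nonzero[OF assms(4)]]
      by (auto simp: W_def)
    ultimately show ?thesis by (simp only:)
  qed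
  have "(\<Sum>j=2..d. s j * v (j - 1)) = (\<Sum>k=1..<d. s (Suc k) * v k)"
    by (rule sum.reindex_bij_witness[of _ Suc "\<lambda>j. j - 1"]) auto
  also have "\<dots> = (\<Sum>k=1..<d. I * I * g k)"
    by (rule sum.cong) (simp_all add: s v g_def mult_ac)
  finally have mid: "(\<Sum>j=2..d. s j * v (j - 1)) = (\<Sum>k=1..<d. I * I * g k)" .
  have first: "s 1 * I = I * I * g 0"
    using s[of 0] assms(5) by (simp add: g_def F0 mult_ac)
  have last: "I * v d = I * I * g d"
    using v assms(5) by (simp add: g_def G0 mult_ac)
  have "{..d} = insert 0 (insert d {1..<d})"
    using assms(5) by auto
  hence "(\<Sum>k\<le>d. I * I * g k) = I * I * g 0 + (\<Sum>k=1..<d. I * I * g k) + I * I * g d"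
    using assms(5) by (simp add: add_ac)
  hence "s 1 * I + (\<Sum>j=2..d. s j * v (j - 1)) + I * v d = I * I * (\<Sum>k\<le>d. g k)"
    unfolding first mid last by (simp only: sum_distrib_left)
  also have "\<dots> = (\<Sum>k\<le>d. g k) * inverse W ^ (2 * w)"
    unfolding I_def mult_2 power_add by (rule mult.commute)
  finally have "s 1 * I + (\<Sum>j=2..d. s j * v (j - 1)) + I * v d =
      (\<Sum>k\<le>d. g k) * inverse W ^ (2 * w)" .
  moreover have "(\<Sum>k\<le>d. g k) \<in> Fq_fps emb"
    unfolding g_def by (rule cmpl_cmspl_alternating_sum_in_Fq_fps[OF F G])
  ultimately show ?thesis
    unfolding I_def by blast
qed

end
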